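(* Let $W_n$ be the set of elements of the triangle group $T$ that can be written as a word of length at most $n$ in the generators $S_1,S_2,S_3,S_4$. Then $|W_n|=O(\lambda^n)$, where $\lambda=\frac{1+\sqrt{13}}{2}$.
   Context: The triangle group $T\subset GL(4,\mathbb{Z})$ is generated by $S_1=\begin{pmatrix}-1&1&1&1\\0&1&0&0\\0&0&1&0\\0&0&0&1\end{pmatrix}$, $S_2=\begin{pmatrix}1&0&0&0\\1&-1&1&1\\0&0&1&0\\0&0&0&1\end{pmatrix}$, $S_3=\begin{pmatrix}1&0&0&0\\0&1&0&0\\1&1&-1&1\\0&0&0&1\end{pmatrix}$, $S_4=\begin{pmatrix}1&0&0&0\\0&1&0&0\\0&0&1&0\\1&1&1&-1\end{pmatrix}$. *)

theory Defs
  imports "HOL-Analysis.Analysis" "HOL-Algebra.Generated_Groups" "HOL-Library.Landau_Symbols"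
begin

definition GL4Z :: "(int^4^4) monoid" where
  "GL4Z = units_of \<lparr>carrier = UNIV, mult = (**), one = mat 1\<rparr>"

definition S1 :: "int^4^4" where
  "S1 = vector [vector [-1, 1, 1, 1],
                vector [ 0, 1, 0, 0],
                vector [ 0, 0, 1, 0],
                vector [ 0, 0, 0, 1]]"

definition S2 :: "int^4^4" where
  "S2 = vector [vector [1,  0, 0, 0],
                vector [1, -1, 1, 1],
                vector [0,  0, 1, 0],
                vector [0,  0, 0, 1]]"

definition S3 :: "int^4^4" where
  "S3 = vector [vector [1, 0,  0, 0],
                vector [0, 1,  0, 0],
                vector [1, 1, -1, 1],
                vector [0, 0,  0, 1]]"

definition S4 :: "int^4^4" where
  "S4 = vector [vector [1, 0, 0,  0],
                vector [0, 1, 0,  0],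
                vector [0, 0, 1,  0],
                vector [1, 1, 1, -1]]"

definition triangle_gens :: "(int^4^4) set" where
  "triangle_gens = {S1, S2, S3, S4}"

definition triangle_group :: "(int^4^4) set" where
  "triangle_group = generate GL4Z triangle_gens"

text \<open>Words use the generators only, not their inverses; this loses nothing, since each
  generator is an involution (see \<open>triangle_gens_involution\<close> below).\<close>

definition word_prod :: "(int^4^4) list \<Rightarrow> int^4^4" where
  "word_prod w = foldr (**) w (mat 1)"

definition W :: "nat \<Rightarrow> (int^4^4) set" where
  "W n = {A \<in> triangle_group.
            \<exists>w. set w \<subseteq> triangle_gens \<and> length w \<le> n \<and> A = word_prod w}"

lemma vector_4_nth:
  "(vector [a, b, c, d] :: ('a::zero)^4) $ 1 = a"
  "(vector [a, b, c, d] :: 'a^4) $ 2 = b"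
  "(vector [a, b, c, d] :: 'a^4) $ 3 = c"
  "(vector [a, b, c, d] :: 'a^4) $ 4 = d"
  by (simp_all add: vector_def)

lemma triangle_gens_involution:
  assumes "A \<in> triangle_gens"
  shows "A ** A = mat 1"
  using assms
  by (auto simp: triangle_gens_def S1_def S2_def S3_def S4_def matrix_matrix_mult_def mat_def
      vec_eq_iff forall_4 sum_4 vector_4_nth)

lemma triangle_gens_subset: "triangle_gens \<subseteq> carrier GL4Z"
  using triangle_gens_involution
  by (auto simp: GL4Z_def units_of_def Units_def)

text \<open>In particular \<open>card (W n)\<close> is the true number of elements.\<close>

lemma finite_W: "finite (W n)"
proof -
  have "finite {w. set w \<subseteq> triangle_gens \<and> length w \<le> n}"
    by (rule finite_lists_length_le) (simp add: triangle_gens_def)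
  moreover have "W n \<subseteq> word_prod ` {w. set w \<subseteq> triangle_gens \<and> length w \<le> n}"
    by (auto simp: W_def)
  ultimately show ?thesis
    using finite_surj by blast
qed

end

theory Submission
  imports Defs
begin

text \<open>The generators are the simple reflections of the Coxeter group with four generators and all
  products of two distinct ones of order three. Let \<open>desc A\<close> be the set of \<open>i\<close> such that multiplying
  \<open>A\<close> by the \<open>i\<close>-th reflection shortens it; by positivity of roots, \<open>A\<close> has at most two descents,
  and two descents \<open>i, j\<close> mean that a reduced word for \<open>A\<close> ends in \<open>i j i\<close>. Removing these endings
  gives linear recurrences for the number \<open>a n\<close> of elements of length \<open>n\<close> and for the total numbers of
  descents and of pairs of descents. Together they yield \<open>a (n + 2) = a (n + 1) + 3 * a n + 6\<close> for
  \<open>n > 0\<close>, and \<open>\<lambda>\<close> is the positive root of \<open>x\<^sup>2 = x + 3\<close>.\<close>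

section \<open>Simple reflections as integer matrices\<close>

definition reflection :: "'n::finite \<Rightarrow> int^'n^'n" where
  "reflection i = (\<chi> r c. if r = i then (if c = i then -1 else 1) else if r = c then 1 else 0)"

text \<open>In the basis of simple roots, reflection \<open>i\<close> sends root \<open>j\<close> to
  the sum of roots \<open>i\<close> and \<open>j\<close>. Hence right multiplication is a column
  operation, and all later computations with products reduce to this formula.\<close>

lemma mult_reflection_nth:
  "(A ** reflection i) $ r $ j = (if j = i then - A $ r $ i else A $ r $ j + A $ r $ i)"
proof -
  have "(A ** reflection i) $ r $ j = (\<Sum>k\<in>UNIV. A $ r $ k * reflection i $ k $ j)"
    by (simp add: matrix_matrix_mult_def)
  also have "\<dots> = A $ r $ i * reflection i $ i $ j + (\<Sum>k\<in>UNIV - {i}. A $ r $ k * reflection i $ k $ j)"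
    by (simp add: sum.remove)
  also have "(\<Sum>k\<in>UNIV - {i}. A $ r $ k * reflection i $ k $ j)
      = (\<Sum>k\<in>UNIV - {i}. if k = j then A $ r $ k else 0)"
    by (rule sum.cong) (auto simp: reflection_def)
  also have "\<dots> = (if j = i then 0 else A $ r $ j)"
    by simp
  finally show ?thesis
    by (auto simp: reflection_def)
qed

lemma reflection_reflection [simp]: "A ** reflection i ** reflection i = A"
  by (simp add: vec_eq_iff mult_reflection_nth)

lemma reflection_braid:
  assumes "i \<noteq> j"
  shows "A ** reflection i ** reflection j ** reflection i
    = A ** reflection j ** reflection i ** reflection j"
  using assms
  by (auto simp: vec_eq_iff mult_reflection_nth)

text \<open>Needed for parity: the determinant of a product then depends only on the parity of the
  word length.\<close>

lemma det_reflection: "det (reflection i :: int^'n::finite^'n) = -1"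
proof -
  \<comment> \<open>Row \<open>i\<close> is split into signed unit vectors. By linearity only the
    \<open>j = i\<close> summand survives, since every other one has equal rows \<open>i\<close> and
    \<open>j\<close>.\<close>
  define a where "a = (\<lambda>(k :: 'n) j. (if j = i then -1 else 1) *s (axis j 1 :: int^'n))"
  have "sum (a k) UNIV $ c = (if c = i then -1 else 1)" for k c
  proof -
    have "sum (a k) UNIV $ c = (\<Sum>j\<in>UNIV. if j = c then if c = i then -1 else 1 else 0)"
      unfolding sum_component by (rule sum.cong) (auto simp: a_def axis_def)
    then show ?thesis
      by simp
  qed
  then have "reflection i = (\<chi> k. if k = i then sum (a k) UNIV else axis k 1)"
    by (auto simp: reflection_def vec_eq_iff axis_def)
  then have "det (reflection i) = (\<Sum>j\<in>UNIV. det (\<chi> k. if k = i then a k j else axis k 1))"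
    by (simp add: det_linear_row_sum)
  also have "\<dots> = (\<Sum>j\<in>UNIV. if j = i then -1 else 0)"
  proof (rule sum.cong)
    fix j
    have "det (\<chi> k. if k = i then a k j else axis k 1)
        = (if j = i then -1 else 1) * det (\<chi> k. if k = i then axis j 1 else axis k (1::int))"
      unfolding a_def by (rule det_row_mul)
    also have "\<dots> = (if j = i then -1 else 0)"
    proof (cases "j = i")
      case True
      then have "(\<chi> k. if k = i then axis j 1 else axis k (1::int)) = mat 1"
        by (auto simp: vec_eq_iff mat_def axis_def)
      with True show ?thesis
        by simp
    next
      case False
      have "det (\<chi> k. if k = i then axis j 1 else axis k (1::int)) = 0"
        by (rule det_identical_rows[of i j]) (use False in \<open>auto simp: row_def vec_eq_iff\<close>)
      with False show ?thesis
        by simp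
    qed
    finally show "det (\<chi> k. if k = i then a k j else axis k 1) = (if j = i then -1 else 0)" .
  qed simp
  finally show ?thesis
    by simp
qed

section \<open>Words, the generated group and length\<close>

definition refl_prod :: "'n::finite list \<Rightarrow> int^'n^'n" where
  "refl_prod w = foldl (\<lambda>A i. A ** reflection i) (mat 1) w"

lemma refl_prod_Nil [simp]: "refl_prod [] = mat 1"
  and refl_prod_snoc [simp]: "refl_prod (w @ [i]) = refl_prod w ** reflection i"
  by (simp_all add: refl_prod_def)

lemma refl_prod_append: "refl_prod (v @ w) = refl_prod v ** refl_prod w"
  by (induction w rule: rev_induct)
    (simp_all add: matrix_mul_assoc flip: append_assoc)

lemma refl_prod_rev: "refl_prod (rev w) ** refl_prod w = mat 1"
proof (induction w rule: rev_induct)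
  case (snoc i w)
  have "refl_prod (rev (w @ [i])) ** refl_prod (w @ [i])
      = refl_prod [i] ** (refl_prod (rev w) ** refl_prod w) ** reflection i"
    using refl_prod_append[of "[i]" "rev w"] by (simp add: matrix_mul_assoc)
  also have "\<dots> = mat 1"
    using snoc.IH refl_prod_snoc[of "[]" i] reflection_reflection[of "mat 1" i] by simp
  finally show ?case .
qed simp

lemma det_refl_prod: "det (refl_prod w) = (-1) ^ length w"
  by (induction w rule: rev_induct) (simp_all add: det_mul det_reflection)

definition refl_group :: "(int^'n::finite^'n) set" where
  "refl_group = range refl_prod"

lemma refl_group_mult [simp]: "A \<in> refl_group \<Longrightarrow> A ** reflection i \<in> refl_group"
  unfolding refl_group_def by (metis imageE rangeI refl_prod_snoc)

text \<open>A left inverse would carry a vanishing sum of columns to a vanishing sum of columns of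
  the identity.\<close>

lemma refl_group_sum_columns_nonzero:
  assumes "A \<in> refl_group" "I \<noteq> {}"
  shows "\<exists>r. (\<Sum>i\<in>I. A $ r $ i) \<noteq> 0"
proof (rule ccontr)
  assume *: "\<not> ?thesis"
  obtain B where B: "B ** A = mat 1"
    using assms(1) refl_prod_rev by (auto simp: refl_group_def)
  obtain k where k: "k \<in> I"
    using assms(2) by blast
  have "(\<Sum>i\<in>I. (B ** A) $ k $ i) = (\<Sum>r\<in>UNIV. B $ k $ r * (\<Sum>i\<in>I. A $ r $ i))"
    by (simp add: matrix_matrix_mult_def sum_distrib_left sum.swap[of _ I])
  with * have "(\<Sum>i\<in>I. (B ** A) $ k $ i) = 0"
    by simp
  with B k show False
    by (simp add: mat_def)
qed

text \<open>The Coxeter length; it is meaningful only on \<open>refl_group\<close>, since other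
  matrices have no word.\<close>

definition len :: "int^'n::finite^'n \<Rightarrow> nat" where
  "len A = (LEAST n. \<exists>w. length w = n \<and> refl_prod w = A)"

lemma len_refl_prod_le: "len (refl_prod w) \<le> length w"
  unfolding len_def by (rule Least_le) blast

lemma obtain_reduced_word:
  assumes "A \<in> refl_group"
  obtains w where "refl_prod w = A" "length w = len A"
proof -
  have "\<exists>n w. length w = n \<and> refl_prod w = A"
    using assms by (auto simp: refl_group_def)
  then have "\<exists>w. length w = len A \<and> refl_prod w = A"
    unfolding len_def by (rule LeastI_ex)
  with that show ?thesis
    by blast
qed

lemma len_mat_1 [simp]: "len (mat 1) = 0"
  using len_refl_prod_le[of "[]"] by simp

lemma len_mult_reflection_le:
  assumes "A \<in> refl_group"
  shows "len (A ** reflection i) \<le> len A + 1"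
  using obtain_reduced_word[OF assms] len_refl_prod_le[of "_ @ [i]"]
  by (metis length_append_singleton refl_prod_snoc Suc_eq_plus1)

lemma len_mult_reflection_neq:
  assumes "A \<in> refl_group"
  shows "len (A ** reflection i) \<noteq> len A"
proof
  assume *: "len (A ** reflection i) = len A"
  have det: "det B = (-1) ^ len B" if "B \<in> refl_group" for B :: "int^'a^'a"
    using obtain_reduced_word[OF that] det_refl_prod by metis
  have "det (A ** reflection i) = - det A"
    by (simp add: det_mul det_reflection)
  then show False
    using * assms by (simp add: det)
qed

section \<open>Descents and the signs of columns\<close>

definition desc :: "int^'n::finite^'n \<Rightarrow> 'n set" where
  "desc A = {i. len (A ** reflection i) < len A}"

lemma len_mult_reflection:
  assumes "A \<in> refl_group"
  shows "i \<in> desc A \<Longrightarrow> len A = Suc (len (A ** reflection i))"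
    and "i \<notin> desc A \<Longrightarrow> len (A ** reflection i) = Suc (len A)"
  using len_mult_reflection_le[OF assms, of i] len_mult_reflection_neq[OF assms, of i]
    len_mult_reflection_le[OF refl_group_mult[OF assms], of i i]
  by (auto simp: desc_def)

lemma desc_mult_reflection: "A \<in> refl_group \<Longrightarrow> i \<in> desc (A ** reflection i) \<longleftrightarrow> i \<notin> desc A"
  using len_mult_reflection_neq[of A i] by (auto simp: desc_def)

lemma desc_nonempty:
  assumes "A \<in> refl_group" "len A > 0"
  shows "desc A \<noteq> {}"
proof -
  obtain w where w: "refl_prod w = A" "length w = len A"
    using obtain_reduced_word[OF assms(1)] .
  with assms(2) obtain v i where v: "w = v @ [i]"
    by (cases w rule: rev_cases) auto
  have "A ** reflection i = refl_prod v"
    using w(1) v by (metis refl_prod_snoc reflection_reflection)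
  moreover have "len (refl_prod v) < len A"
    using len_refl_prod_le[of v] w(2) v by simp
  ultimately have "i \<in> desc A"
    by (simp add: desc_def)
  then show ?thesis
    by blast
qed

text \<open>The columns of \<open>A\<close> are the images of the simple roots, so this is the usual criterion
  that \<open>A\<close> gets longer by \<open>reflection i\<close> iff it keeps the \<open>i\<close>-th simple root positive.\<close>

lemma column_nonneg:
  assumes "A \<in> refl_group" "i \<notin> desc A"
  shows "0 \<le> A $ r $ i"
  using assms
proof (induction "len A" arbitrary: A i rule: less_induct)
  case less
  note G = \<open>A \<in> refl_group\<close>
  show ?case
  proof (cases "len A = 0")
    case True
    then have "A = mat 1"
      using obtain_reduced_word[OF G] by (metis length_0_conv refl_prod_Nil)
    then show ?thesis
      by (simp add: mat_def)
  next
    case False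
    then obtain j where j: "j \<in> desc A"
      using desc_nonempty[OF G] by auto
    with less.prems have ij: "i \<noteq> j"
      by auto
    define B where "B = A ** reflection j"
    have B: "B \<in> refl_group" "A = B ** reflection j" "len A = Suc (len B)" "j \<notin> desc B"
      using G j len_mult_reflection(1)[OF G j] desc_mult_reflection[OF G, of j] by (simp_all add: B_def)
    show ?thesis
    proof (cases "i \<in> desc B")
      case False
      then have "0 \<le> B $ r $ i" "0 \<le> B $ r $ j"
        using less.hyps[of B] B by auto
      then show ?thesis
        using ij by (simp add: B(2) mult_reflection_nth)
    next
      case True
      \<comment> \<open>Column \<open>i\<close> of \<open>A\<close> equals column \<open>j\<close>
        of \<open>C\<close>, so it suffices that \<open>j\<close> is no descent of
        \<open>C\<close>.\<close>
      define C where "C = B ** reflection i"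
      have C: "C \<in> refl_group" "B = C ** reflection i" "len B = Suc (len C)" "i \<notin> desc C"
        using B(1) True len_mult_reflection(1)[OF B(1) True] desc_mult_reflection[OF B(1), of i]
        by (simp_all add: C_def)
      have "j \<notin> desc C"
      proof
        assume "j \<in> desc C"
        then have CD: "len C = Suc (len (C ** reflection j))"
          using len_mult_reflection(1)[OF C(1)] by blast
        \<comment> \<open>By the braid relation \<open>A ** reflection i\<close> would have length
          at most \<open>len C + 1\<close>, whereas it has length \<open>len C + 3\<close> because
          \<open>i\<close> is no descent of \<open>A\<close>.\<close>
        have "A ** reflection i = C ** reflection j ** reflection i ** reflection j"
          unfolding B(2) C(2) by (rule reflection_braid[OF ij])
        then have "len (A ** reflection i) \<le> len (C ** reflection j) + 2"
          using len_mult_reflection_le[of "C ** reflection j" i]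
            len_mult_reflection_le[of "C ** reflection j ** reflection i" j] C(1) by simp
        with CD show False
          using B(3) C(3) len_mult_reflection(2)[OF G less.prems(2)] by simp
      qed
      then have "0 \<le> C $ r $ j"
        using less.hyps[of C j] B C by auto
      then show ?thesis
        using ij by (simp add: B(2) C(2) mult_reflection_nth)
    qed
  qed
qed

lemma column_nonpos:
  assumes "A \<in> refl_group" "i \<in> desc A"
  shows "A $ r $ i \<le> 0"
  using column_nonneg[of "A ** reflection i" i r] assms desc_mult_reflection[of A i]
  by (simp add: mult_reflection_nth)

lemma column_nonzero: "A \<in> refl_group \<Longrightarrow> \<exists>r. A $ r $ i \<noteq> 0"
  using refl_group_sum_columns_nonzero[of A "{i}"] by simp

text \<open>A column is nonzero and of constant sign, so its sign decides. Descents can now be found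
  by column arithmetic.\<close>

lemma desc_iff: "A \<in> refl_group \<Longrightarrow> i \<in> desc A \<longleftrightarrow> (\<forall>r. A $ r $ i \<le> 0)"
  by (metis column_nonneg column_nonpos column_nonzero order_antisym)

lemma not_desc_iff: "A \<in> refl_group \<Longrightarrow> i \<notin> desc A \<longleftrightarrow> (\<forall>r. 0 \<le> A $ r $ i)"
  by (metis column_nonneg column_nonpos column_nonzero order_antisym)

text \<open>The product \<open>i j i\<close> is the longest element of the order-six subgroup
  generated by both reflections. It replaces columns \<open>i\<close> and \<open>j\<close> by the
  negatives of columns \<open>j\<close> and \<open>i\<close>, so both signs flip; on the way down,
  the three columns met are nonpositive, so each step shortens.\<close>

lemma desc_pair:
  assumes "A \<in> refl_group" "i \<noteq> j" "i \<in> desc A" "j \<in> desc A"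
  defines "B \<equiv> A ** reflection i ** reflection j ** reflection i"
  shows "len A = len B + 3" "i \<notin> desc B" "j \<notin> desc B"
proof -
  have "j \<in> desc (A ** reflection i)" "i \<in> desc (A ** reflection i ** reflection j)"
    using assms by (auto simp: desc_iff mult_reflection_nth add_nonpos_nonpos)
  then show "len A = len B + 3"
    using assms(1,3) len_mult_reflection(1)[of A i] len_mult_reflection(1)[of "A ** reflection i" j]
      len_mult_reflection(1)[of "A ** reflection i ** reflection j" i]
    by (simp add: B_def)
  have "A $ r $ i \<le> 0" "A $ r $ j \<le> 0" for r
    using assms(1,3,4) by (auto simp: desc_iff)
  then show "i \<notin> desc B" "j \<notin> desc B"
    using assms(1,2) by (simp_all add: B_def not_desc_iff mult_reflection_nth)
qed

lemma desc_pair_converse: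
  assumes "B \<in> refl_group" "i \<noteq> j" "i \<notin> desc B" "j \<notin> desc B"
  defines "A \<equiv> B ** reflection i ** reflection j ** reflection i"
  shows "i \<in> desc A" "j \<in> desc A"
proof -
  have "0 \<le> B $ r $ i" "0 \<le> B $ r $ j" for r
    using assms(1,3,4) by (auto simp: column_nonneg)
  then show "i \<in> desc A" "j \<in> desc A"
    using assms(1,2) by (simp_all add: A_def desc_iff mult_reflection_nth)
qed

text \<open>The sum of three simple roots is fixed by the three reflections, which together generate
  an infinite (affine) group: if \<open>A\<close> makes this sum nonpositive, then one of the three is a descent
  of \<open>A\<close>, and removing it gives a shorter element doing the same.\<close>

lemma sum_three_columns_pos:
  assumes "A \<in> refl_group" "card I = 3"
  shows "\<exists>r. 0 < (\<Sum>i\<in>I. A $ r $ i)"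
  using assms(1)
proof (induction "len A" arbitrary: A rule: less_induct)
  case less
  show ?case
  proof (cases "I \<inter> desc A = {}")
    case True
    then have "0 \<le> (\<Sum>i\<in>I. A $ r $ i)" for r
      using column_nonneg[OF less.prems] by (intro sum_nonneg) auto
    moreover have "I \<noteq> {}"
      using assms(2) by auto
    then obtain r where "(\<Sum>i\<in>I. A $ r $ i) \<noteq> 0"
      using refl_group_sum_columns_nonzero[OF less.prems] by blast
    ultimately have "0 < (\<Sum>i\<in>I. A $ r $ i)"
      by (simp add: order_less_le)
    then show ?thesis ..
  next
    case False
    then obtain i where i: "i \<in> I" "i \<in> desc A"
      by auto
    have fin: "finite I"
      by simp
    have card: "card (I - {i}) = 2"
      using i(1) assms(2) by simp
    \<comment> \<open>The two other columns of \<open>I\<close> each gain column \<open>i\<close>,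
      which exactly offsets its change of sign.\<close>
    have "(\<Sum>j\<in>I. (A ** reflection i) $ r $ j) = (\<Sum>j\<in>I. A $ r $ j)" for r
    proof -
      have "(\<Sum>j\<in>I. (A ** reflection i) $ r $ j) = - A $ r $ i + (\<Sum>j\<in>I - {i}. A $ r $ j + A $ r $ i)"
        by (simp add: sum.remove[OF fin i(1)] mult_reflection_nth)
      also have "\<dots> = A $ r $ i + (\<Sum>j\<in>I - {i}. A $ r $ j)"
        using card by (simp add: sum.distrib)
      also have "\<dots> = (\<Sum>j\<in>I. A $ r $ j)"
        by (simp add: sum.remove[OF fin i(1)])
      finally show ?thesis .
    qed
    moreover have "\<exists>r. 0 < (\<Sum>j\<in>I. (A ** reflection i) $ r $ j)"
      using less.hyps[of "A ** reflection i"] less.prems i(2) by (simp add: desc_def)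
    ultimately show ?thesis
      by simp
  qed
qed

lemma card_desc_le_2:
  assumes "A \<in> refl_group"
  shows "card (desc A) \<le> 2"
proof (rule ccontr)
  assume "\<not> ?thesis"
  then obtain I where I: "I \<subseteq> desc A" "card I = 3"
    by (metis obtain_subset_with_card_n not_less_eq_eq numeral_2_eq_2 numeral_3_eq_3)
  then have "(\<Sum>i\<in>I. A $ r $ i) \<le> 0" for r
    using column_nonpos[OF assms] by (intro sum_nonpos) auto
  then show False
    using sum_three_columns_pos[OF assms I(2)] by (meson not_less)
qed

section \<open>Spheres and recurrences for descent counts\<close>

definition word_sphere :: "nat \<Rightarrow> (int^'n::finite^'n) set" where
  "word_sphere n = {A \<in> refl_group. len A = n}"

lemma finite_word_sphere: "finite (word_sphere n :: (int^'n::finite^'n) set)"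
proof -
  have "finite {w :: 'n list. set w \<subseteq> UNIV \<and> length w = n}"
    by (rule finite_lists_length_eq) simp
  moreover have "word_sphere n \<subseteq> refl_prod ` {w :: 'n list. set w \<subseteq> UNIV \<and> length w = n}"
  proof
    fix A :: "int^'n^'n" assume "A \<in> word_sphere n"
    then have A: "A \<in> refl_group" "len A = n"
      by (simp_all add: word_sphere_def)
    from A(1) obtain w where "refl_prod w = A" "length w = len A"
      by (rule obtain_reduced_word)
    with A(2) show "A \<in> refl_prod ` {w. set w \<subseteq> UNIV \<and> length w = n}"
      by blast
  qed
  ultimately show ?thesis
    using finite_surj by blast
qed

lemma word_sphere_0: "word_sphere 0 = {mat 1}"
proof -
  have "mat 1 \<in> refl_group"
    unfolding refl_group_def by (rule range_eqI[of _ _ "[]"]) simp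
  moreover have "A = mat 1" if "A \<in> refl_group" "len A = 0" for A :: "int^'a^'a"
    using obtain_reduced_word[OF that(1)] that(2) by (metis length_0_conv refl_prod_Nil)
  ultimately show ?thesis
    unfolding word_sphere_def using len_mat_1 by blast
qed

text \<open>The argument \<open>T\<close> records the index type, which the value alone cannot
  determine. Integer values avoid truncated subtraction.\<close>

definition num_desc :: "nat \<Rightarrow> 'n::finite itself \<Rightarrow> int" where
  "num_desc n T = (\<Sum>A\<in>(word_sphere n :: (int^'n^'n) set). int (card (desc A)))"

text \<open>The pairs are ordered.\<close>

definition num_desc_pairs :: "nat \<Rightarrow> 'n::finite itself \<Rightarrow> int" where
  "num_desc_pairs n T =
     (\<Sum>A\<in>(word_sphere n :: (int^'n^'n) set). int (card (desc A)) * (int (card (desc A)) - 1))"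

lemma int_card_Compl: "int (card (- X)) = int CARD('n) - int (card X)" for X :: "'n::finite set"
  by (simp add: Compl_eq_Diff_UNIV card_Diff_subset of_nat_diff card_mono)

text \<open>Double counting of the Cayley graph edges between consecutive spheres: each is a descent
  of its upper end and a non-descent of its lower end.\<close>

lemma num_desc_Suc:
  fixes T :: "'n::finite itself"
  shows "num_desc (Suc n) T
    = int CARD('n) * int (card (word_sphere n :: (int^'n^'n) set)) - num_desc n T"
proof -
  let ?S = "word_sphere :: nat \<Rightarrow> (int^'n^'n) set"
  have down: "len (A ** reflection i) = n"
    if "A \<in> refl_group" "len A = Suc n" "i \<in> desc A" for A :: "int^'n^'n" and i
    using len_mult_reflection(1)[OF that(1,3)] that(2) by simp
  have "bij_betw (\<lambda>(A, i). (A ** reflection i, i)) (SIGMA A:?S (Suc n). desc A) (SIGMA A:?S n. - desc A)"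
    by (rule bij_betw_byWitness[where f' = "\<lambda>(A, i). (A ** reflection i, i)"])
      (auto simp: word_sphere_def desc_mult_reflection down len_mult_reflection(2))
  then have "card (SIGMA A:?S (Suc n). desc A) = card (SIGMA A:?S n. - desc A)"
    by (rule bij_betw_same_card)
  then have "num_desc (Suc n) T = (\<Sum>A\<in>?S n. int (card (- desc A)))"
    by (simp add: num_desc_def finite_word_sphere flip: of_nat_sum)
  also have "\<dots> = (\<Sum>A\<in>?S n. int CARD('n) - int (card (desc A)))"
    by (simp add: int_card_Compl)
  finally show ?thesis
    by (simp add: num_desc_def sum_subtractf)
qed

lemma card_ordered_pairs:
  assumes "finite X"
  shows "int (card {(i, j). i \<in> X \<and> j \<in> X \<and> i \<noteq> j}) = int (card X) * (int (card X) - 1)"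
proof -
  have "{(i, j). i \<in> X \<and> j \<in> X \<and> i \<noteq> j} = (SIGMA i:X. X - {i})"
    by auto
  then have "int (card {(i, j). i \<in> X \<and> j \<in> X \<and> i \<noteq> j}) = (\<Sum>i\<in>X. int (card (X - {i})))"
    using assms by simp
  also have "\<dots> = (\<Sum>i\<in>X. int (card X) - 1)"
    using assms card_gt_0_iff[of X] by (intro sum.cong) (auto simp: of_nat_diff)
  finally show ?thesis
    by simp
qed

text \<open>Double counting of cosets of the order-six subgroups: the top element has both descents,
  the bottom one has neither, and their lengths differ by three. The map \<open>?f\<close> between
  them is its own inverse.\<close>

lemma num_desc_pairs_add_3:
  fixes T :: "'n::finite itself"
  shows "num_desc_pairs (n + 3) T
    = int CARD('n) * (int CARD('n) - 1) * int (card (word_sphere n :: (int^'n^'n) set))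
      - 2 * (int CARD('n) - 1) * num_desc n T + num_desc_pairs n T"
proof -
  let ?S = "word_sphere :: nat \<Rightarrow> (int^'n^'n) set"
  let ?P = "\<lambda>X. {(i, j). i \<in> X \<and> j \<in> X \<and> i \<noteq> j}"
  let ?f = "\<lambda>(A :: int^'n^'n, i, j). (A ** reflection i ** reflection j ** reflection i, i, j)"
  have up: "len (A ** reflection i ** reflection j ** reflection i) = len A + 3"
    if "A \<in> refl_group" "i \<noteq> j" "i \<notin> desc A" "j \<notin> desc A" for A :: "int^'n^'n" and i j
    using desc_pair(1)[of "A ** reflection i ** reflection j ** reflection i" i j] desc_pair_converse[OF that] that
    by simp
  have down: "len (A ** reflection i ** reflection j ** reflection i) = n"
    if "A \<in> refl_group" "len A = n + 3" "i \<noteq> j" "i \<in> desc A" "j \<in> desc A" for A :: "int^'n^'n" and i j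
    using desc_pair(1)[OF that(1,3-5)] that(2) by simp
  have "bij_betw ?f (SIGMA A:?S (n + 3). ?P (desc A)) (SIGMA A:?S n. ?P (- desc A))"
    by (rule bij_betw_byWitness[where f' = ?f])
      (auto simp: word_sphere_def desc_pair_converse up down desc_pair(2,3))
  then have "card (SIGMA A:?S (n + 3). ?P (desc A)) = card (SIGMA A:?S n. ?P (- desc A))"
    by (rule bij_betw_same_card)
  then have "num_desc_pairs (n + 3) T = (\<Sum>A\<in>?S n. int (card (?P (- desc A))))"
    by (simp add: num_desc_pairs_def finite_word_sphere flip: of_nat_sum card_ordered_pairs)
  also have "\<dots> = (\<Sum>A\<in>?S n. (int CARD('n) - int (card (desc A))) * (int CARD('n) - int (card (desc A)) - 1))"
    by (simp only: card_ordered_pairs finite int_card_Compl)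
  \<comment> \<open>Expanded so that the quadratic term is again the summand of
    \<open>num_desc_pairs\<close>.\<close>
  also have "\<dots> = (\<Sum>A\<in>?S n. int CARD('n) * (int CARD('n) - 1)
      - 2 * (int CARD('n) - 1) * int (card (desc A)) + int (card (desc A)) * (int (card (desc A)) - 1))"
    by (simp add: algebra_simps)
  finally show ?thesis
    by (simp add: num_desc_def num_desc_pairs_def sum_subtractf sum.distrib sum_distrib_left)
qed

text \<open>Inclusion-exclusion: a set of one or two descents satisfies
  \<open>1 = card D - card D * (card D - 1) / 2\<close>.\<close>

lemma card_word_sphere_eq:
  fixes T :: "'n::finite itself"
  assumes "n > 0"
  shows "2 * int (card (word_sphere n :: (int^'n^'n) set)) = 2 * num_desc n T - num_desc_pairs n T"
proof -
  let ?S = "word_sphere n :: (int^'n^'n) set"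
  have "2 * int (card ?S) = (\<Sum>A\<in>?S. 2)"
    by simp
  also have "\<dots> = (\<Sum>A\<in>?S. 2 * int (card (desc A)) - int (card (desc A)) * (int (card (desc A)) - 1))"
  proof (rule sum.cong)
    fix A assume "A \<in> ?S"
    then have "card (desc A) \<le> 2" "card (desc A) \<noteq> 0"
      using card_desc_le_2[of A] desc_nonempty[of A] assms by (auto simp: word_sphere_def)
    then have "card (desc A) = 1 \<or> card (desc A) = 2"
      by linarith
    then show "2 = 2 * int (card (desc A)) - int (card (desc A)) * (int (card (desc A)) - 1)"
      by auto
  qed simp
  finally show ?thesis
    by (simp add: num_desc_def num_desc_pairs_def sum_subtractf sum_distrib_left)
qed

lemma num_desc_0: "num_desc 0 T = 0"
  by (simp add: num_desc_def word_sphere_0 desc_def)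

text \<open>By \<open>desc_pair\<close>, two distinct descents force length at least three.\<close>

lemma num_desc_pairs_eq_0:
  assumes "n < 3"
  shows "num_desc_pairs n (T :: 'n::finite itself) = 0"
  unfolding num_desc_pairs_def
proof (rule sum.neutral, rule ballI)
  fix A :: "int^'n^'n" assume A: "A \<in> word_sphere n"
  have "card (desc A) \<le> 1"
  proof (rule ccontr)
    assume "\<not> ?thesis"
    then obtain i j where "i \<in> desc A" "j \<in> desc A" "i \<noteq> j"
      by (metis card_le_Suc0_iff_eq finite One_nat_def)
    then show False
      using desc_pair(1)[of A i j] A assms by (simp add: word_sphere_def)
  qed
  then have "card (desc A) = 0 \<or> card (desc A) = 1"
    by linarith
  then show "int (card (desc A)) * (int (card (desc A)) - 1) = 0"
    by auto
qed

section \<open>The recurrence and growth bound for four generators\<close>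

lemma card_word_sphere_4:
  defines "a \<equiv> \<lambda>n. int (card (word_sphere n :: (int^4^4) set))"
  shows "a 1 = 4" "a 2 = 12" "n > 0 \<Longrightarrow> a (n + 2) = a (n + 1) + 3 * a n + 6"
proof -
  define b where "b = (\<lambda>n. num_desc n TYPE(4))"
  define c where "c = (\<lambda>n. num_desc_pairs n TYPE(4))"
  have b: "b (Suc n) = 4 * a n - b n" for n
    using num_desc_Suc[of n "TYPE(4)"] by (simp add: a_def b_def)
  have c: "c (Suc (Suc (Suc n))) = 12 * a n - 6 * b n + c n" for n
    using num_desc_pairs_add_3[of n "TYPE(4)"] by (simp add: a_def b_def c_def numeral_3_eq_3)
  have a: "2 * a (Suc n) = 2 * b (Suc n) - c (Suc n)" for n
    using card_word_sphere_eq[of "Suc n" "TYPE(4)"] by (simp add: a_def b_def c_def)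
  have init: "a 0 = 1" "b 0 = 0" "c 0 = 0" "c (Suc 0) = 0" "c (Suc (Suc 0)) = 0"
    by (simp_all add: a_def b_def c_def word_sphere_0 num_desc_0 num_desc_pairs_eq_0)
  have a1: "a (Suc 0) = 4" and a2: "a (Suc (Suc 0)) = 12"
    using init a[of 0] a[of "Suc 0"] b[of 0] b[of "Suc 0"] by simp_all
  then show "a 1 = 4" "a 2 = 12"
    by (simp_all add: numeral_2_eq_2)
  \<comment> \<open>Subtracting two instances of \<open>a\<close> at distance three eliminates
    \<open>c\<close>.\<close>
  have ab: "a (Suc (Suc (Suc (Suc n)))) = b (Suc (Suc (Suc (Suc n)))) - 5 * a (Suc n) + 2 * b (Suc n)" for n
    using a[of "Suc (Suc (Suc n))"] a[of n] c[of "Suc n"] by simp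
  \<comment> \<open>The defect of the intended recurrence. It is 5 at index 0, so the constant value
    6 starts at index 1.\<close>
  define e where "e = (\<lambda>n. a (Suc (Suc n)) - a (Suc n) - 3 * a n)"
  have e: "e (Suc n) = 6 \<and> e (Suc (Suc n)) = 6" for n
  proof (induction n)
    case 0
    have b1: "b (Suc 0) = 4" and b2: "b (Suc (Suc 0)) = 12"
      using b[of 0] b[of "Suc 0"] init a1 by simp_all
    have b3: "b (Suc (Suc (Suc 0))) = 36"
      using b[of "Suc (Suc 0)"] a2 b2 by simp
    have a3: "a (Suc (Suc (Suc 0))) = 30"
      using a[of "Suc (Suc 0)"] b3 c[of 0] init by simp
    have a4: "a (Suc (Suc (Suc (Suc 0)))) = 72"
      using a[of "Suc (Suc (Suc 0))"] b[of "Suc (Suc (Suc 0))"] b1 b3 a1 a3 c[of "Suc 0"] init by simp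
    show ?case
      by (simp add: e_def a1 a2 a3 a4)
  next
    case (Suc n)
    \<comment> \<open>Adding two consecutive instances of \<open>ab\<close> eliminates
      \<open>b\<close> and leaves a recurrence with characteristic polynomial
      \<open>(x - 1)^2 * (x^2 - x - 3)\<close>. So the second difference of \<open>e\<close>
      vanishes, and two equal values make it constant.\<close>
    have "e (Suc (Suc (Suc n))) - 2 * e (Suc (Suc n)) + e (Suc n) = 0"
      using ab[of n] ab[of "Suc n"] b[of "Suc n"] b[of "Suc (Suc (Suc (Suc n)))"]
      by (simp add: e_def)
    with Suc show ?case
      by simp
  qed
  show "a (n + 2) = a (n + 1) + 3 * a n + 6" if "n > 0"
  proof -
    from that obtain m where "n = Suc m"
      by (cases n) auto
    with e[of m] show ?thesis
      by (simp add: e_def)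
  qed
qed

lemma card_word_sphere_le:
  "real (card (word_sphere n :: (int^4^4) set)) \<le> 6 * ((1 + sqrt 13) / 2) ^ n"
proof -
  \<comment> \<open>The shift by 2 absorbs the constant 6 and makes the recurrence
    homogeneous.\<close>
  define g where "g = (\<lambda>n. real (card (word_sphere n :: (int^4^4) set)) + 2)"
  define x :: real where "x = (1 + sqrt 13) / 2"
  have x: "x ^ 2 = x + 3"
    by (simp add: x_def power2_eq_square field_simps)
  have "sqrt 9 \<le> sqrt 13"
    by (rule real_sqrt_le_mono) simp
  then have x2: "x \<ge> 2"
    by (simp add: x_def)
  have rec: "g (n + 2) = g (n + 1) + 3 * g n" if "n > 0" for n
  proof -
    have "real_of_int (int (card (word_sphere (n + 2) :: (int^4^4) set)))
      = real_of_int (int (card (word_sphere (n + 1) :: (int^4^4) set))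
          + 3 * int (card (word_sphere n :: (int^4^4) set)) + 6)"
      using card_word_sphere_4(3)[OF that] by (rule arg_cong)
    then show ?thesis
      by (simp add: g_def)
  qed
  \<comment> \<open>The induction starts at index 1, where the recurrence begins; index 0 is checked
    separately.\<close>
  have "g (Suc n) \<le> 6 * x ^ Suc n \<and> g (Suc (Suc n)) \<le> 6 * x ^ Suc (Suc n)" for n
  proof (induction n)
    case 0
    show ?case
      using card_word_sphere_4(1,2) x2 x by (simp add: g_def power2_eq_square numeral_2_eq_2)
  next
    case (Suc n)
    have "6 * x ^ Suc (Suc (Suc n)) = 6 * x ^ Suc n * x ^ 2"
      by (simp add: power2_eq_square)
    also have "\<dots> = 6 * x ^ Suc (Suc n) + 3 * (6 * x ^ Suc n)"
      unfolding x by (simp add: algebra_simps)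
    finally show ?case
      using Suc rec[of "Suc n"] by simp
  qed
  moreover have "g 0 \<le> 6 * x ^ 0"
    by (simp add: g_def word_sphere_0)
  ultimately have "g n \<le> 6 * x ^ n"
    by (cases n) auto
  then show ?thesis
    by (simp add: g_def x_def)
qed

section \<open>Transfer to the triangle group\<close>

lemma triangle_gens_eq: "triangle_gens = range reflection"
proof -
  have "reflection 1 = S1" "reflection 2 = S2" "reflection 3 = S3" "reflection 4 = S4"
    by (simp_all add: vec_eq_iff forall_4 vector_4_nth reflection_def S1_def S2_def S3_def S4_def)
  then have "triangle_gens = reflection ` {1, 2, 3, 4}"
    by (simp add: triangle_gens_def)
  also have "{1, 2, 3, 4} = (UNIV :: 4 set)"
    using exhaust_4 by auto
  finally show ?thesis .
qed

text \<open>The two products fold from opposite ends; associativity reconciles them.\<close>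

lemma word_prod_map_reflection: "word_prod (map reflection v) = refl_prod v"
proof (induction v)
  case (Cons i v)
  then show ?case
    using refl_prod_append[of "[i]" v] refl_prod_snoc[of "[]" i] by (simp add: word_prod_def)
qed (simp add: word_prod_def)

lemma W_subset: "W n \<subseteq> (\<Union>k\<le>n. word_sphere k)"
proof
  fix A assume "A \<in> W n"
  then obtain w where w: "set w \<subseteq> triangle_gens" "length w \<le> n" "A = word_prod w"
    by (auto simp: W_def)
  then have "\<exists>v. w = map reflection v"
    unfolding ex_map_conv triangle_gens_eq by blast
  then obtain v where "w = map reflection v" ..
  with w have "A = refl_prod v" "length v \<le> n"
    by (simp_all add: word_prod_map_reflection)
  then show "A \<in> (\<Union>k\<le>n. word_sphere k)"
    using len_refl_prod_le[of v] by (auto simp: word_sphere_def refl_group_def)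
qed

theorem theorem5:
  shows "(\<lambda>n. real (card (W n))) \<in> O(\<lambda>n. ((1 + sqrt 13) / 2) ^ n)"
proof (rule bigoI)
  define x :: real where "x = (1 + sqrt 13) / 2"
  have "sqrt 9 \<le> sqrt 13"
    by (rule real_sqrt_le_mono) simp
  then have x: "x \<ge> 2"
    by (simp add: x_def)
  have "real (card (W n)) \<le> 12 * x ^ n" for n
  proof -
    have "card (W n) \<le> card (\<Union>k\<le>n. word_sphere k :: (int^4^4) set)"
      using W_subset by (intro card_mono) (auto simp: finite_word_sphere)
    also have "\<dots> \<le> (\<Sum>k\<le>n. card (word_sphere k :: (int^4^4) set))"
      by (rule card_UN_le) simp
    finally have "real (card (W n)) \<le> (\<Sum>k\<le>n. real (card (word_sphere k :: (int^4^4) set)))"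
      by (simp flip: of_nat_sum)
    also have "\<dots> \<le> (\<Sum>k\<le>n. 6 * x ^ k)"
      unfolding x_def by (intro sum_mono card_word_sphere_le)
    \<comment> \<open>Since \<open>x\<close> is at least 2, the next term
      \<open>6 * x ^ Suc n\<close> is at least the bound \<open>12 * x ^ n\<close> reached so far,
      and their sum is at most \<open>12 * x ^ Suc n\<close>.\<close>
    also have "\<dots> \<le> 12 * x ^ n"
    proof (induction n)
      case (Suc n)
      have "12 * x ^ n \<le> 6 * (x * x ^ n)"
        using x mult_right_mono[of 2 x "6 * x ^ n"] by simp
      with Suc show ?case
        by simp
    qed simp
    finally show ?thesis .
  qed
  then show "\<forall>\<^sub>F n in sequentially. norm (real (card (W n))) \<le> 12 * norm (((1 + sqrt 13) / 2) ^ n)"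
    using x by (simp add: x_def)
qed

end
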